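(* For each real number $p>0$, let $R_{p\text{-power}}$ be the $p$-power scoring rule, which on every instance selects a candidate $a$ maximizing $\sum_{i\in N_a} f_i^p$, breaking ties arbitrarily. For each $s\in(0,1)$, we have $$\mathrm{FVR}(R_{p\text{-power}},s)=\frac{1}{1+\frac{(s(1+p))^{1+p}}{p^p}}.$$
   Context: An (approval) instance consists of a finite non-empty set $N$ of $n$ voters, a finite non-empty set $M$ of $m$ candidates, and an approval set $A_i\subseteq M$ for each voter $i\in N$. For a candidate $a$, $N_a=\{i\in N\mid a\in A_i\}$ is the set of voters approving $a$. A single-winner rule $R$ selects, for every instance (for all $n$ and $m$), a single candidate in $M$. For a voter $i$, let $f_i=|A_i|/m$; for $s\in(0,1)$, voter $i$ is $s$-flexible if $f_i\ge s$. For a rule $R$ and $s\in(0,1)$, $\mathrm{FVR}(R,s)$ is the smallest $r\in[0,1]$ such that for every instance (over all $n$, $m$ and all approval sets), whenever a group of strictly more than $rn$ voters are all $s$-flexible, at least one voter in the group approves the candidate chosen by $R$ on that instance. (This minimum always exists.) *)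

theory Defs
  imports Complex_Main "HOL-Library.FuncSet" "HOL-Library.Infinite_Typeclass"
begin

record ('v, 'c) approval_instance =
  voters :: "'v set"
  candidates :: "'c set"
  approvals :: "'v \<Rightarrow> 'c set"

text \<open>
  The ballots are extensional (undefined outside the voters), so that an instance carries no
  data beyond the approval sets of its voters, and a rule cannot depend on any.
\<close>

definition valid_instance :: "('v, 'c) approval_instance \<Rightarrow> bool" where
  "valid_instance I \<longleftrightarrow>
     finite (voters I) \<and> voters I \<noteq> {} \<and>
     finite (candidates I) \<and> candidates I \<noteq> {} \<and>
     approvals I \<in> voters I \<rightarrow>\<^sub>E Pow (candidates I)"

definition approvers :: "('v, 'c) approval_instance \<Rightarrow> 'c \<Rightarrow> 'v set" where
  "approvers I a = {i \<in> voters I. a \<in> approvals I i}"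

definition flexibility :: "('v, 'c) approval_instance \<Rightarrow> 'v \<Rightarrow> real" where
  "flexibility I i = real (card (approvals I i)) / real (card (candidates I))"

definition flexible :: "real \<Rightarrow> ('v, 'c) approval_instance \<Rightarrow> 'v \<Rightarrow> bool" where
  "flexible s I i \<longleftrightarrow> s \<le> flexibility I i"

definition single_winner_rule :: "(('v, 'c) approval_instance \<Rightarrow> 'c) \<Rightarrow> bool" where
  "single_winner_rule R \<longleftrightarrow> (\<forall>I. valid_instance I \<longrightarrow> R I \<in> candidates I)"

definition represents_flexible_groups ::
    "(('v, 'c) approval_instance \<Rightarrow> 'c) \<Rightarrow> real \<Rightarrow> real \<Rightarrow> bool" where
  "represents_flexible_groups R s r \<longleftrightarrow>
     (\<forall>I G. valid_instance I \<longrightarrow> G \<subseteq> voters I \<longrightarrow> (\<forall>i\<in>G. flexible s I i) \<longrightarrow>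
        real (card G) > r * real (card (voters I)) \<longrightarrow> (\<exists>i\<in>G. R I \<in> approvals I i))"

text \<open>
  The types of voters and candidates are required to be infinite so that instances of all sizes
  occur in the quantification over instances.
\<close>

definition FVR :: "(('v::infinite, 'c::infinite) approval_instance \<Rightarrow> 'c) \<Rightarrow> real \<Rightarrow> real" where
  "FVR R s = (LEAST r. 0 \<le> r \<and> r \<le> 1 \<and> represents_flexible_groups R s r)"

text \<open>The minimum is attained, so the use of \<open>LEAST\<close> on the reals is justified.\<close>

lemma FVR_least:
  fixes R :: "('v::infinite, 'c::infinite) approval_instance \<Rightarrow> 'c"
  shows "0 \<le> FVR R s" "FVR R s \<le> 1" "represents_flexible_groups R s (FVR R s)"
    and "\<And>r. 0 \<le> r \<Longrightarrow> r \<le> 1 \<Longrightarrow> represents_flexible_groups R s r \<Longrightarrow> FVR R s \<le> r"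
proof -
  let ?P = "\<lambda>r. 0 \<le> r \<and> r \<le> 1 \<and> represents_flexible_groups R s r"
  define S where "S = {r. ?P r}"
  have one: "1 \<in> S"
    unfolding S_def represents_flexible_groups_def valid_instance_def
    by (auto simp: not_less dest: card_mono)
  have bdd: "bdd_below S"
    by (rule bdd_belowI[of _ 0]) (simp add: S_def)
  have low: "Inf S \<le> r" if "?P r" for r
    using bdd that by (auto intro!: cInf_lower simp: S_def)
  have "0 \<le> Inf S"
    using one by (intro cInf_greatest) (auto simp: S_def)
  moreover have "Inf S \<le> 1"
    using one bdd by (rule cInf_lower)
  moreover have "represents_flexible_groups R s (Inf S)"
    unfolding represents_flexible_groups_def
  proof (intro allI impI)
    fix I :: "('v, 'c) approval_instance" and G
    assume I: "valid_instance I" and G: "G \<subseteq> voters I" "\<forall>i\<in>G. flexible s I i"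
      and gt: "real (card G) > Inf S * real (card (voters I))"
    have n: "0 < real (card (voters I))"
      using I by (auto simp: valid_instance_def card_gt_0_iff)
    have "Inf S < real (card G) / real (card (voters I))"
      using gt n by (simp add: pos_less_divide_eq)
    then obtain r where r: "r \<in> S" "r < real (card G) / real (card (voters I))"
      using one bdd cInf_less_iff[of S] by auto
    then have "real (card G) > r * real (card (voters I))"
      using n by (simp add: pos_less_divide_eq)
    then show "\<exists>i\<in>G. R I \<in> approvals I i"
      using r I G by (auto simp: S_def represents_flexible_groups_def)
  qed
  ultimately have P: "?P (Inf S)" by simp
  then have eq: "FVR R s = Inf S"
    unfolding FVR_def using low by (intro Least_equality) auto
  show "0 \<le> FVR R s" "FVR R s \<le> 1" "represents_flexible_groups R s (FVR R s)"
    using P eq by auto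
  show "\<And>r. 0 \<le> r \<Longrightarrow> r \<le> 1 \<Longrightarrow> represents_flexible_groups R s r \<Longrightarrow> FVR R s \<le> r"
    using low eq by auto
qed

definition power_score :: "real \<Rightarrow> ('v, 'c) approval_instance \<Rightarrow> 'c \<Rightarrow> real" where
  "power_score p I a = (\<Sum>i\<in>approvers I a. flexibility I i powr p)"

text \<open>Every choice of tie-breaking yields one of the rules satisfying this predicate.\<close>

definition power_rule :: "real \<Rightarrow> (('v, 'c) approval_instance \<Rightarrow> 'c) \<Rightarrow> bool" where
  "power_rule p R \<longleftrightarrow> single_winner_rule R \<and>
     (\<forall>I. valid_instance I \<longrightarrow> is_arg_max (power_score p I) (\<lambda>a. a \<in> candidates I) (R I))"

end

theory Submission
  imports Defs "HOL-Real_Asymp.Real_Asymp"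
begin

text \<open>
  The average score of a candidate is \<open>\<Sum>\<^sub>i f\<^sub>i powr (1 + p)\<close>, and the winner \<open>w\<close> does at least as
  well. If no voter of an \<open>s\<close>-flexible group \<open>G\<close> approves \<open>w\<close>, subtracting the contribution of
  the approvers of \<open>w\<close> to the average leaves
  \<open>|G| s powr (1 + p) \<le> \<Sum>\<^sub>i f\<^sub>i powr p * (1 - f\<^sub>i)\<close>, summed over the approvers of \<open>w\<close>, and each
  term on the right is at most the maximum of \<open>x powr p * (1 - x)\<close>, attained at \<open>x = p / (1 + p)\<close>.
  Both estimates are asymptotically sharp: let the voters outside \<open>G\<close> approve \<open>w\<close> together with
  about a fraction \<open>p / (1 + p)\<close> of the other candidates, let the voters in \<open>G\<close> approve about a
  fraction \<open>s\<close> of the candidates other than \<open>w\<close>, and arrange both kinds of ballots cyclically so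
  that all candidates other than \<open>w\<close> have the same score.
\<close>

section \<open>The maximum of \<open>x powr p * (1 - x)\<close> on the unit interval\<close>

lemma powr_mult_one_minus_le:
  fixes p x :: real
  assumes "p > 0" "0 \<le> x" "x \<le> 1"
  shows "x powr p * (1 - x) \<le> p powr p / (1 + p) powr (1 + p)"
proof (cases "x = 0 \<or> x = 1")
  case True
  then show ?thesis using assms by auto
next
  case False
  then have x: "0 < x" "x < 1" using assms by auto
  \<comment> \<open>Both \<open>u\<close> and \<open>v\<close> equal 1 at the maximiser
    \<open>x = p / (1 + p)\<close>, where \<open>ln t \<le> t - 1\<close> is tight. Weighted by
    \<open>p\<close> and 1, the two linear bounds cancel for every \<open>x\<close>, since
    \<open>p * u + v = p + 1\<close>.\<close>
  define u where "u = x * (1 + p) / p"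
  define v where "v = (1 - x) * (1 + p)"
  have uv: "u > 0" "v > 0" using x assms by (simp_all add: u_def v_def)
  have "p * ln u + ln v \<le> p * (u - 1) + (v - 1)"
    using uv assms by (intro add_mono mult_left_mono ln_le_minus_one) auto
  also have "\<dots> = 0"
    using assms by (simp add: u_def v_def field_simps)
  finally have "exp (p * ln u + ln v) \<le> 1" by simp
  then have "u powr p * v \<le> 1"
    using uv by (simp add: exp_add powr_def)
  moreover have "u powr p = x powr p * (1 + p) powr p / p powr p"
    using x assms by (simp add: u_def powr_divide powr_mult)
  ultimately have "x powr p * (1 + p) powr p / p powr p * ((1 - x) * (1 + p)) \<le> 1"
    by (simp add: v_def)
  then have "(x powr p * (1 - x)) * (1 + p) powr (1 + p) \<le> p powr p"
    using assms by (simp add: powr_add pos_divide_le_eq algebra_simps)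
  then show ?thesis
    using assms by (simp add: pos_le_divide_eq)
qed

lemma critical_value:
  fixes p :: real
  assumes "p > 0"
  shows "(p / (1 + p)) powr p * (1 - p / (1 + p)) = p powr p / (1 + p) powr (1 + p)"
  using assms by (simp add: powr_divide powr_add field_simps)

section \<open>Upper bound by averaging the scores\<close>

lemma flexibility_bounds:
  assumes "valid_instance I" "i \<in> voters I"
  shows "0 \<le> flexibility I i" "flexibility I i \<le> 1"
proof -
  have "approvals I i \<subseteq> candidates I" "finite (candidates I)" "candidates I \<noteq> {}"
    using assms by (auto simp: valid_instance_def PiE_def Pi_def)
  then show "0 \<le> flexibility I i" "flexibility I i \<le> 1"
    by (auto simp: flexibility_def divide_le_eq_1 card_gt_0_iff card_mono)
qed

text \<open>Double counting: with m candidates, voter i gives \<open>f_i powr p\<close> to each of m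
  * \<open>f_i\<close> candidates, which contributes m * \<open>f_i powr (1 + p)\<close> in
  total.\<close>

lemma sum_power_score:
  assumes I: "valid_instance I"
  shows "(\<Sum>a\<in>candidates I. power_score p I a) =
    real (card (candidates I)) * (\<Sum>i\<in>voters I. flexibility I i powr (1 + p))"
proof -
  have fin: "finite (voters I)" "finite (candidates I)" "candidates I \<noteq> {}"
    and app: "\<And>i. i \<in> voters I \<Longrightarrow> approvals I i \<subseteq> candidates I"
    using I by (auto simp: valid_instance_def PiE_def Pi_def)
  have "(\<Sum>a\<in>candidates I. power_score p I a) =
      (\<Sum>a\<in>candidates I. \<Sum>i\<in>voters I. if a \<in> approvals I i then flexibility I i powr p else 0)"
    unfolding power_score_def approvers_def
    using fin by (intro sum.cong refl sum.inter_filter) auto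
  also have "\<dots> =
      (\<Sum>i\<in>voters I. \<Sum>a\<in>candidates I. if a \<in> approvals I i then flexibility I i powr p else 0)"
    by (rule sum.swap)
  also have "\<dots> = (\<Sum>i\<in>voters I. real (card (candidates I)) * flexibility I i powr (1 + p))"
  proof (rule sum.cong[OF refl])
    fix i assume i: "i \<in> voters I"
    have "(\<Sum>a\<in>candidates I. if a \<in> approvals I i then flexibility I i powr p else 0) =
        real (card (approvals I i)) * flexibility I i powr p"
      using fin app[OF i] by (simp flip: sum.inter_restrict add: Int_absorb1)
    also have "\<dots> = real (card (candidates I)) * (flexibility I i * flexibility I i powr p)"
      using fin by (simp add: flexibility_def)
    also have "flexibility I i * flexibility I i powr p = flexibility I i powr (1 + p)"
      using flexibility_bounds(1)[OF I i] by (simp add: powr_mult_base)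
    finally show "(\<Sum>a\<in>candidates I. if a \<in> approvals I i then flexibility I i powr p else 0) =
        real (card (candidates I)) * flexibility I i powr (1 + p)" .
  qed
  finally show ?thesis by (simp add: sum_distrib_left)
qed

lemma average_le_winner_score:
  assumes I: "valid_instance I" and R: "power_rule p R"
  shows "(\<Sum>i\<in>voters I. flexibility I i powr (1 + p)) \<le> power_score p I (R I)"
proof -
  have "\<And>a. a \<in> candidates I \<Longrightarrow> power_score p I a \<le> power_score p I (R I)"
    using I R by (auto simp: power_rule_def is_arg_max_linorder)
  then have "(\<Sum>a\<in>candidates I. power_score p I a) \<le>
      real (card (candidates I)) * power_score p I (R I)"
    by (rule sum_bounded_above)
  moreover have "card (candidates I) > 0"
    using I by (auto simp: valid_instance_def card_gt_0_iff)
  ultimately show ?thesis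
    by (simp add: sum_power_score[OF I])
qed

lemma unrepresented_group_bound:
  fixes p s :: real
  assumes p: "p > 0" and s: "s > 0" and R: "power_rule p R" and I: "valid_instance I"
    and G: "G \<subseteq> voters I" "\<forall>i\<in>G. flexible s I i" "\<forall>i\<in>G. R I \<notin> approvals I i"
  shows "real (card G) * s powr (1 + p) \<le>
    (real (card (voters I)) - real (card G)) * (p powr p / (1 + p) powr (1 + p))"
proof -
  let ?f = "flexibility I" and ?W = "approvers I (R I)"
  have fin: "finite (voters I)" using I by (simp add: valid_instance_def)
  \<comment> \<open>Disjointness from \<open>G\<close> lets both sets contribute to the average
    separately, and later bounds \<open>card ?W\<close> by the number of voters outside
    \<open>G\<close>.\<close>
  have W: "?W \<subseteq> voters I - G" using G by (auto simp: approvers_def)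
  have finW: "finite ?W" "finite G"
    using W G(1) fin by (auto intro: finite_subset)
  have "real (card G) * s powr (1 + p) \<le> (\<Sum>i\<in>G. ?f i powr (1 + p))"
    using G(2) p s by (intro sum_bounded_below powr_mono2) (auto simp: flexible_def)
  also have "\<dots> + (\<Sum>i\<in>?W. ?f i powr (1 + p)) = (\<Sum>i\<in>G \<union> ?W. ?f i powr (1 + p))"
    using finW W by (intro sum.union_disjoint[symmetric]) auto
  also have "\<dots> \<le> (\<Sum>i\<in>voters I. ?f i powr (1 + p))"
    using fin W G(1) by (intro sum_mono2) auto
  also have "\<dots> \<le> (\<Sum>i\<in>?W. ?f i powr p)"
    using average_le_winner_score[OF I R] by (simp add: power_score_def)
  finally have "real (card G) * s powr (1 + p) \<le>
      (\<Sum>i\<in>?W. ?f i powr p - ?f i powr (1 + p))"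
    by (simp add: sum_subtractf)
  also have "\<dots> = (\<Sum>i\<in>?W. ?f i powr p * (1 - ?f i))"
  proof (rule sum.cong[OF refl])
    fix i assume "i \<in> ?W"
    then have "?f i powr (1 + p) = ?f i * ?f i powr p"
      using W flexibility_bounds(1)[OF I] by (subst powr_mult_base) auto
    then show "?f i powr p - ?f i powr (1 + p) = ?f i powr p * (1 - ?f i)"
      by (simp add: algebra_simps)
  qed
  also have "\<dots> \<le> real (card ?W) * (p powr p / (1 + p) powr (1 + p))"
    using W flexibility_bounds[OF I] p
    by (intro sum_bounded_above powr_mult_one_minus_le) auto
  also have "\<dots> \<le> (real (card (voters I)) - real (card G)) * (p powr p / (1 + p) powr (1 + p))"
  proof (rule mult_right_mono)
    have "card ?W \<le> card (voters I - G)" using W fin by (intro card_mono) auto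
    also have "\<dots> = card (voters I) - card G" using finW G by (simp add: card_Diff_subset)
    finally show "real (card ?W) \<le> real (card (voters I)) - real (card G)"
      using card_mono[OF fin G(1)] by linarith
  qed simp
  finally show ?thesis .
qed

section \<open>Counting residues in cyclic arrangements\<close>

text \<open>M consecutive numbers meet each residue class modulo M once. The induction slides the
  window: \<open>b\<close> leaves and \<open>b + M\<close>, of the same residue, enters.\<close>

lemma card_mod_less_window:
  fixes b M d :: nat
  assumes "d \<le> M"
  shows "card {u \<in> {b..<b + M}. u mod M < d} = d"
proof (induction b)
  case 0
  have "{u \<in> {0..<0 + M}. u mod M < d} = {..<d}" using assms by auto
  then show ?case by simp
next
  case (Suc b)
  show ?case
  proof (cases "M = 0")
    case False
    define S where "S = {u \<in> {Suc b..<b + M}. u mod M < d}"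
    have "{u \<in> {b..<b + M}. u mod M < d} = (if b mod M < d then insert b S else S)"
      using False by (auto simp: S_def Suc_le_eq le_less)
    moreover have "{u \<in> {Suc b..<Suc b + M}. u mod M < d} =
        (if b mod M < d then insert (b + M) S else S)"
      using False by (auto simp: S_def less_Suc_eq)
    moreover have "finite S" "b \<notin> S" "b + M \<notin> S" by (auto simp: S_def)
    ultimately show ?thesis using Suc.IH by (auto split: if_splits)
  qed (use assms in auto)
qed

lemma card_mod_less_windows:
  fixes b k M d :: nat
  assumes "d \<le> M"
  shows "card {u \<in> {b..<b + k * M}. u mod M < d} = k * d"
proof (induction k)
  case (Suc k)
  let ?A = "{u \<in> {b..<b + k * M}. u mod M < d}"
  let ?B = "{u \<in> {b + k * M..<b + k * M + M}. u mod M < d}"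
  have "{u \<in> {b..<b + Suc k * M}. u mod M < d} = ?A \<union> ?B"
    by auto
  moreover have "card (?A \<union> ?B) = card ?A + card ?B"
    by (intro card_Un_disjoint) auto
  moreover have "card ?B = d"
    by (rule card_mod_less_window[OF assms])
  ultimately show ?case using Suc.IH by simp
qed simp

lemma card_add_mod_less_windows:
  fixes b c k M d :: nat
  assumes "d \<le> M"
  shows "card {u \<in> {b..<b + k * M}. (c + u) mod M < d} = k * d"
proof -
  have "(+) c ` {u \<in> {b..<b + k * M}. (c + u) mod M < d} =
      {u \<in> {(c + b)..<(c + b) + k * M}. u mod M < d}"
    (is "_ ` ?A = ?B")
  proof
    show "?B \<subseteq> (+) c ` ?A"
    proof
      fix x assume "x \<in> ?B"
      then have "x = c + (x - c)" "x - c \<in> ?A" by auto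
      then show "x \<in> (+) c ` ?A" by blast
    qed
  qed auto
  then have "card {u \<in> {b..<b + k * M}. (c + u) mod M < d} =
      card {u \<in> {(c + b)..<(c + b) + k * M}. u mod M < d}"
    by (metis (no_types, lifting) card_image inj_on_add)
  then show ?thesis using card_mod_less_windows[OF assms] by simp
qed

section \<open>Lower bound by cyclic instances\<close>

text \<open>The injections \<open>h\<close> and \<open>e\<close> carry a construction on natural
  numbers into arbitrary infinite types; \<open>restrict\<close> makes the ballots extensional, as
  \<open>valid_instance\<close> demands.\<close>

definition indexed_instance ::
    "(nat \<Rightarrow> 'v) \<Rightarrow> (nat \<Rightarrow> 'c) \<Rightarrow> nat \<Rightarrow> nat \<Rightarrow> (nat \<Rightarrow> nat set) \<Rightarrow> ('v, 'c) approval_instance" where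
  "indexed_instance h e n m A =
     \<lparr>voters = h ` {..<n}, candidates = e ` {..<m},
      approvals = restrict (\<lambda>v. e ` A (inv h v)) (h ` {..<n})\<rparr>"

lemma indexed_instance_simps [simp]:
  "voters (indexed_instance h e n m A) = h ` {..<n}"
  "candidates (indexed_instance h e n m A) = e ` {..<m}"
  "inj h \<Longrightarrow> u < n \<Longrightarrow> approvals (indexed_instance h e n m A) (h u) = e ` A u"
  by (auto simp: indexed_instance_def)

lemma valid_indexed_instance:
  assumes "inj h" "n > 0" "m > 0" "\<And>u. u < n \<Longrightarrow> A u \<subseteq> {..<m}"
  shows "valid_instance (indexed_instance h e n m A)"
  using assms by (fastforce simp: valid_instance_def indexed_instance_def)

lemma flexibility_indexed_instance:
  assumes "inj h" "inj e" "u < n"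
  shows "flexibility (indexed_instance h e n m A) (h u) = card (A u) / m"
  using assms by (simp add: flexibility_def card_image inj_on_subset)

lemma power_score_indexed_instance:
  assumes "inj h" "inj e"
  shows "power_score p (indexed_instance h e n m A) (e c) =
    (\<Sum>u | u < n \<and> c \<in> A u. (card (A u) / m) powr p)"
proof -
  have "approvers (indexed_instance h e n m A) (e c) = h ` {u. u < n \<and> c \<in> A u}"
    using assms by (auto simp: approvers_def inj_image_mem_iff)
  then show ?thesis
    using assms by (simp add: power_score_def sum.reindex inj_on_subset flexibility_indexed_instance)
qed

text \<open>The instance has \<open>g * M\<close> group voters, \<open>k * M\<close> others and
  \<open>M + 1\<close> candidates, with index \<open>M\<close> as intended winner. Taking multiples
  of \<open>M\<close> voters makes the cyclic ballots wrap around completely, so all other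
  candidates tie. The assumption \<open>score\<close> says that they lose to candidate
  \<open>M\<close>, with both scores divided by \<open>M\<close>.\<close>

lemma power_rule_cyclic_bound:
  fixes R :: "('v::infinite, 'c::infinite) approval_instance \<Rightarrow> 'c"
    and p s r :: real and g k d e M :: nat
  assumes R: "power_rule p R" and rep: "represents_flexible_groups R s r"
    and M: "M > 0" and de: "d \<le> M" "e \<le> M" and k: "k > 0" and r: "r * (g + k) < g"
    and d: "s * (M + 1) \<le> d"
    and score: "g * (d / M) * (d / (M + 1)) powr p + k * (e / M) * ((e + 1) / (M + 1)) powr p
      < k * ((e + 1) / (M + 1)) powr p"
  shows False
proof -
  obtain h :: "nat \<Rightarrow> 'v" where h: "inj h"
    using infinite_UNIV infinite_countable_subset by blast
  obtain c :: "nat \<Rightarrow> 'c" where c: "inj c"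
    using infinite_UNIV infinite_countable_subset by blast
  define n where "n = g * M + k * M"
  define A where "A u = (if u < g * M then {a. a < M \<and> (a + u) mod M < d}
    else insert M {a. a < M \<and> (a + u) mod M < e})" for u
  define I where "I = indexed_instance h c n (Suc M) A"
  have n: "n > 0" using M k by (simp add: n_def)
  have I: "valid_instance I"
    unfolding I_def using h n by (intro valid_indexed_instance) (auto simp: A_def)
  have window: "card {a. a < M \<and> (a + u) mod M < x} = x" if "x \<le> M" for u x
    using card_add_mod_less_windows[OF that, of 0 1 u] by (simp add: add.commute)
  have card_A: "card (A u) = (if u < g * M then d else Suc e)" for u
    using de by (simp add: A_def window)
  have score_other: "power_score p I (c a) =
      g * d * (d / Suc M) powr p + k * e * (Suc e / Suc M) powr p" if a: "a < M" for a
  proof -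
    \<comment> \<open>The interval is written in the form \<open>{b..<b + k * M}\<close> of the
      counting lemma.\<close>
    let ?D = "{u \<in> {0..<0 + g * M}. (a + u) mod M < d}"
    let ?E = "{u \<in> {g * M..<g * M + k * M}. (a + u) mod M < e}"
    have "{u. u < n \<and> a \<in> A u} = ?D \<union> ?E"
      using a by (auto simp: n_def A_def)
    then have "power_score p I (c a) = (\<Sum>u\<in>?D \<union> ?E. (card (A u) / Suc M) powr p)"
      by (simp only: I_def power_score_indexed_instance[OF h c])
    also have "\<dots> = (\<Sum>u\<in>?D. (card (A u) / Suc M) powr p) + (\<Sum>u\<in>?E. (card (A u) / Suc M) powr p)"
      by (intro sum.union_disjoint) auto
    also have "(\<Sum>u\<in>?D. (card (A u) / Suc M) powr p) = (\<Sum>u\<in>?D. (d / Suc M) powr p)"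
      by (intro sum.cong refl) (auto simp: card_A)
    also have "\<dots> = g * d * (d / Suc M) powr p"
      by (simp only: sum_constant card_add_mod_less_windows[OF de(1)] of_nat_mult)
    also have "(\<Sum>u\<in>?E. (card (A u) / Suc M) powr p) = (\<Sum>u\<in>?E. (Suc e / Suc M) powr p)"
      by (intro sum.cong refl) (auto simp: card_A)
    also have "\<dots> = k * e * (Suc e / Suc M) powr p"
      by (simp only: sum_constant card_add_mod_less_windows[OF de(2)] of_nat_mult)
    finally show ?thesis .
  qed
  have score_winner: "power_score p I (c M) = k * M * (Suc e / Suc M) powr p"
  proof -
    have "{u. u < n \<and> M \<in> A u} = {g * M..<g * M + k * M}"
      by (auto simp: n_def A_def)
    then have "power_score p I (c M) = (\<Sum>u\<in>{g * M..<g * M + k * M}. (card (A u) / Suc M) powr p)"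
      by (simp only: I_def power_score_indexed_instance[OF h c])
    also have "\<dots> = (\<Sum>u\<in>{g * M..<g * M + k * M}. (Suc e / Suc M) powr p)"
      by (intro sum.cong refl) (auto simp: card_A)
    finally show ?thesis by simp
  qed
  have "g * d * (d / Suc M) powr p + k * e * (Suc e / Suc M) powr p
      < k * M * (Suc e / Suc M) powr p"
  proof -
    have "M * (g * (d / M) * (d / (M + 1)) powr p + k * (e / M) * ((e + 1) / (M + 1)) powr p)
        < M * (k * ((e + 1) / (M + 1)) powr p)"
      using score M by (intro mult_strict_left_mono) auto
    then show ?thesis using M by (simp add: distrib_left mult.left_commute mult.assoc add.commute)
  qed
  then have less: "power_score p I (c a) < power_score p I (c M)" if "a < M" for a
    using score_other[OF that] score_winner by simp
  \<comment> \<open>Candidate \<open>M\<close> is the strict maximum, so tie-breaking cannot affect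
    the outcome.\<close>
  have "R I \<in> candidates I" "\<not> power_score p I (R I) < power_score p I (c M)"
    using R I by (auto simp: power_rule_def is_arg_max_def I_def)
  then have winner: "R I = c M"
    using less by (auto simp: I_def less_Suc_eq)
  define G where "G = h ` {..<g * M}"
  have "card G = g * M" "card (voters I) = n"
    using h by (simp_all add: G_def I_def card_image inj_on_subset)
  moreover have "M * (r * (g + k)) < M * real g"
    using r M by (intro mult_strict_left_mono) auto
  ultimately have "r * card (voters I) < card G"
    by (simp add: n_def algebra_simps)
  moreover have "G \<subseteq> voters I" by (auto simp: G_def I_def n_def)
  moreover have "flexible s I i" if "i \<in> G" for i
  proof -
    obtain u where u: "i = h u" "u < g * M" using \<open>i \<in> G\<close> by (auto simp: G_def)
    then have "flexibility I i = d / Suc M"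
      using h c by (simp add: I_def flexibility_indexed_instance card_A n_def)
    then show ?thesis using d by (simp add: flexible_def pos_le_divide_eq)
  qed
  ultimately obtain i where i: "i \<in> G" "R I \<in> approvals I i"
    using rep I unfolding represents_flexible_groups_def by blast
  then obtain u where u: "i = h u" "u < g * M" by (auto simp: G_def)
  then have "c M \<in> c ` A u" using i h winner by (simp add: I_def n_def)
  then show False using c u by (simp add: inj_image_mem_iff A_def)
qed

text \<open>For fixed \<open>g\<close> and \<open>k\<close>, the rounding errors of the cyclic
  instances vanish as \<open>M\<close> grows, so a strict violation in the limit already occurs for
  some finite \<open>M\<close>.\<close>

lemma power_rule_ratio_bound:
  fixes R :: "('v::infinite, 'c::infinite) approval_instance \<Rightarrow> 'c"
    and p s r :: real and g k :: nat
  assumes p: "p > 0" and s: "0 < s" "s < 1"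
    and R: "power_rule p R" and rep: "represents_flexible_groups R s r"
    and k: "k > 0" and r: "r * (g + k) < g"
  shows "k * (p powr p / (1 + p) powr (1 + p)) \<le> g * s powr (1 + p)"
proof (rule ccontr)
  define x where "x = p / (1 + p)"
  assume "\<not> ?thesis"
  then have "g * s powr (1 + p) < k * (x powr p * (1 - x))"
    using critical_value[OF p] by (simp add: x_def)
  then have lt: "g * s * s powr p + k * x * x powr p < k * x powr p"
    using s by (simp add: powr_add algebra_simps)
  have x: "0 < x" "x < 1" using p by (auto simp: x_def)
  \<comment> \<open>Rounding up keeps the group \<open>s\<close>-flexible among \<open>M + 1\<close>
    candidates; rounding down keeps \<open>e M \<le> M\<close>.\<close>
  define d where "d M = nat \<lceil>s * (real M + 1)\<rceil>" for M :: nat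
  define e where "e M = nat \<lfloor>x * real M\<rfloor>" for M :: nat
  have real_d: "real (d M) = real_of_int \<lceil>s * (real M + 1)\<rceil>" for M
    using s by (simp add: d_def less_imp_le)
  have real_e: "real (e M) = real_of_int \<lfloor>x * real M\<rfloor>" for M
    using x by (simp add: e_def)
  have lim: "(\<lambda>M. real (d M) / real M) \<longlonglongrightarrow> s" "(\<lambda>M. real (d M) / (real M + 1)) \<longlonglongrightarrow> s"
    "(\<lambda>M. real (e M) / real M) \<longlonglongrightarrow> x" "(\<lambda>M. (real (e M) + 1) / (real M + 1)) \<longlonglongrightarrow> x"
    unfolding real_d real_e using s x by real_asymp+
  have "(\<lambda>M. g * (d M / M) * (d M / (real M + 1)) powr p
        + k * (e M / M) * ((real (e M) + 1) / (real M + 1)) powr p)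
      \<longlonglongrightarrow> g * s * s powr p + k * x * x powr p"
    using s x by (intro tendsto_intros lim) auto
  moreover have "(\<lambda>M. k * ((real (e M) + 1) / (real M + 1)) powr p) \<longlonglongrightarrow> k * x powr p"
    using x by (intro tendsto_intros lim) auto
  ultimately have "(\<lambda>M. k * ((real (e M) + 1) / (real M + 1)) powr p -
        (g * (d M / M) * (d M / (real M + 1)) powr p
          + k * (e M / M) * ((real (e M) + 1) / (real M + 1)) powr p))
      \<longlonglongrightarrow> k * x powr p - (g * s * s powr p + k * x * x powr p)"
    by (intro tendsto_diff)
  then have "\<forall>\<^sub>F M in sequentially. 0 < k * ((real (e M) + 1) / (real M + 1)) powr p -
        (g * (d M / M) * (d M / (real M + 1)) powr p
          + k * (e M / M) * ((real (e M) + 1) / (real M + 1)) powr p)"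
    using lt by (intro order_tendstoD(1)) auto
  then have "\<forall>\<^sub>F M in sequentially. g * (d M / M) * (d M / (real M + 1)) powr p
        + k * (e M / M) * ((real (e M) + 1) / (real M + 1)) powr p
      < k * ((real (e M) + 1) / (real M + 1)) powr p"
    by simp
  \<comment> \<open>Rounding up may exceed \<open>M\<close> for small \<open>M\<close>, but not for
    large \<open>M\<close>, because \<open>s < 1\<close>.\<close>
  moreover have "\<forall>\<^sub>F M in sequentially. real (d M) / real M < 1"
    using lim(1) s by (auto dest: order_tendstoD)
  moreover have "\<forall>\<^sub>F M :: nat in sequentially. M > 0"
    by (rule eventually_gt_at_top)
  ultimately have "\<forall>\<^sub>F M :: nat in sequentially. False"
  proof eventually_elim
    case (elim M)
    have "e M \<le> M"
    proof -
      have "real (e M) \<le> x * real M" by (simp add: real_e)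
      also have "\<dots> \<le> 1 * real M" using x by (intro mult_right_mono) auto
      finally show ?thesis by simp
    qed
    moreover have "d M \<le> M" using elim by simp
    moreover have "s * (M + 1) \<le> d M" by (simp add: real_d add.commute)
    ultimately show False
      using elim power_rule_cyclic_bound[OF R rep _ _ _ k r, of M "d M" "e M"]
      by (simp add: add.commute)
  qed
  then show False by simp
qed

theorem theorem2p4:
  fixes p s :: real
    and R :: "('v::infinite, 'c::infinite) approval_instance \<Rightarrow> 'c"
  assumes "p > 0"
    and "power_rule p R"
    and "0 < s" and "s < 1"
  shows "FVR R s = 1 / (1 + (s * (1 + p)) powr (1 + p) / p powr p)"
proof -
  \<comment> \<open>The claimed value \<open>c / (c + S)\<close> is the fraction r at which the two
    bounds balance: r * \<open>S\<close> = (1 - r) * \<open>c\<close>.\<close>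
  define c where "c = p powr p / (1 + p) powr (1 + p)"
  define S where "S = s powr (1 + p)"
  have pos: "c > 0" "S > 0" using assms by (simp_all add: c_def S_def)
  have "(s * (1 + p)) powr (1 + p) / p powr p = S / c"
    using assms by (simp add: powr_mult c_def S_def)
  then have rhs: "1 / (1 + (s * (1 + p)) powr (1 + p) / p powr p) = c / (c + S)"
    using pos by (simp only:) (simp add: field_simps)
  have "FVR R s \<le> c / (c + S)"
  proof (rule FVR_least(4))
    show "represents_flexible_groups R s (c / (c + S))"
      unfolding represents_flexible_groups_def
    proof (intro allI impI, rule ccontr)
      fix I :: "('v, 'c) approval_instance" and G
      assume I: "valid_instance I" and G: "G \<subseteq> voters I" "\<forall>i\<in>G. flexible s I i"
        and gt: "real (card G) > c / (c + S) * real (card (voters I))"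
        and "\<not> (\<exists>i\<in>G. R I \<in> approvals I i)"
      then have "real (card G) * S \<le> (real (card (voters I)) - real (card G)) * c"
        unfolding S_def c_def using assms by (intro unrepresented_group_bound) auto
      then show False using gt pos by (simp add: field_simps)
    qed
  qed (use pos in auto)
  moreover have "c / (c + S) \<le> FVR R s"
  proof (rule ccontr)
    assume "\<not> ?thesis"
    \<comment> \<open>A rational group fraction \<open>q = g / n\<close> supplies the integer sizes
      \<open>g\<close> and \<open>n - g\<close> for the cyclic instances. Being above
      \<open>FVR R s\<close>, it forces such a group to be represented; being below
      \<open>c / (c + S)\<close>, it violates the resulting inequality.\<close>
    then obtain q where q: "q \<in> \<rat>" "FVR R s < q" "q < c / (c + S)"
      using Rats_dense_in_real[of "FVR R s" "c / (c + S)"] by auto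
    have "q > 0" using q(2) FVR_least(1)[of R s] by simp
    then obtain g n :: nat where gn: "n \<noteq> 0" "q = real g / real n"
      using Rats_abs_nat_div_natE[OF q(1)] by (metis abs_of_pos)
    have "c / (c + S) < 1" using pos by simp
    then have "real g / real n < 1" using q(3) gn(2) by linarith
    then have "g < n" using gn(1) by simp
    have "real (n - g) * c \<le> real g * S"
      unfolding c_def S_def
    proof (rule power_rule_ratio_bound[OF assms(1,3,4,2) FVR_least(3)])
      show "FVR R s * real (g + (n - g)) < real g"
        using q(2) gn \<open>g < n\<close> by (simp add: less_divide_eq)
    qed (use \<open>g < n\<close> in simp)
    moreover have "real g * (c + S) < real n * c"
      using q(3) gn pos by (simp add: field_simps)
    ultimately show False using \<open>g < n\<close> by (simp add: of_nat_diff algebra_simps)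
  qed
  ultimately show ?thesis using rhs by simp
qed

end
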